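(* If $r \geq 1$ is an even integer, then $\tilde{m}_2(r) \geq 2^{r-1} + 1$.
   Context: A hypergraph $\mathcal{H}$ on a set $X$ (of vertices) is a collection of subsets of $X$, called edges; it is $r$-uniform if every edge has exactly $r$ elements. $|\mathcal{H}|$ is the number of edges. Each nonnegative integer $k$ is identified with the set $\{0,\dots,k-1\}$. Functions are identified with their graphs, so $\subseteq$, $\cap$ may be applied to functions. $[X \rightharpoonup k]$ denotes the set of all partial maps from $X$ to $k$, i.e. functions $\varphi$ defined on a subset $\mathrm{dom}(\varphi)$ of $X$ with values in $k$. For $\mathcal{F} \subseteq [X \rightharpoonup k]$, $\mathrm{dom}(\mathcal{F}) := \{\mathrm{dom}(\varphi) : \varphi \in \mathcal{F}\}$. An $\mathcal{F}$-coloring is a (total) function $f \colon X \to k$ such that $\varphi \not\subseteq f$ for all $\varphi \in \mathcal{F}$. A $k$-fold cover of a hypergraph $\mathcal{H}$ on $X$ is a family $\mathcal{F} \subseteq [X \rightharpoonup k]$ such that $\mathrm{dom}(\mathcal{F}) \subseteq \mathcal{H}$ and, whenever $\varphi, \psi \in \mathcal{F}$ are distinct with $\mathrm{dom}(\varphi) = \mathrm{dom}(\psi)$, we have $\varphi \cap \psi = \varnothing$ (i.e. $\varphi(x)\neq\psi(x)$ for every $x$ in the common domain). A hypergraph $\mathcal{H}$ is $k$-DP-colorable if every $k$-fold cover $\mathcal{F}$ of $\mathcal{H}$ admits an $\mathcal{F}$-coloring. For integers $r,k\ge 1$, $\tilde{m}_k(r)$ denotes the minimum $|\mathcal{H}|$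 over all $r$-uniform hypergraphs $\mathcal{H}$ that are not $k$-DP-colorable. *)

theory Defs
  imports Main "HOL-Library.Extended_Nat"
begin

definition hypergraph_on :: "'a set \<Rightarrow> 'a set set \<Rightarrow> bool" where
  "hypergraph_on X H \<longleftrightarrow> H \<subseteq> Pow X"

text \<open>Finiteness is stated separately because \<^const>\<open>card\<close> of an infinite set is 0.\<close>

definition uniform :: "nat \<Rightarrow> 'a set set \<Rightarrow> bool" where
  "uniform r H \<longleftrightarrow> (\<forall>e\<in>H. finite e \<and> card e = r)"

definition num_edges :: "'a set set \<Rightarrow> enat" where
  "num_edges H = (if finite H then enat (card H) else \<infinity>)"

definition partial_maps :: "'a set \<Rightarrow> nat \<Rightarrow> ('a \<rightharpoonup> nat) set" where
  "partial_maps X k = {\<phi>. dom \<phi> \<subseteq> X \<and> ran \<phi> \<subseteq> {..<k}}"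

text \<open>A colouring \<open>f : X \<rightarrow> k\<close> is a partial map with domain exactly \<open>X\<close>, so that the
  inclusion of graphs of functions is \<^const>\<open>map_le\<close>.\<close>

definition is_coloring :: "'a set \<Rightarrow> nat \<Rightarrow> ('a \<rightharpoonup> nat) set \<Rightarrow> ('a \<rightharpoonup> nat) \<Rightarrow> bool" where
  "is_coloring X k F f \<longleftrightarrow>
     dom f = X \<and> ran f \<subseteq> {..<k} \<and> (\<forall>\<phi>\<in>F. \<not> \<phi> \<subseteq>\<^sub>m f)"

definition fold_cover :: "'a set \<Rightarrow> nat \<Rightarrow> 'a set set \<Rightarrow> ('a \<rightharpoonup> nat) set \<Rightarrow> bool" where
  "fold_cover X k H F \<longleftrightarrow>
     F \<subseteq> partial_maps X k \<and> dom ` F \<subseteq> H \<and>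
     (\<forall>\<phi>\<in>F. \<forall>\<psi>\<in>F. \<phi> \<noteq> \<psi> \<and> dom \<phi> = dom \<psi> \<longrightarrow> Map.graph \<phi> \<inter> Map.graph \<psi> = {})"

definition DP_colorable :: "'a set \<Rightarrow> nat \<Rightarrow> 'a set set \<Rightarrow> bool" where
  "DP_colorable X k H \<longleftrightarrow> (\<forall>F. fold_cover X k H F \<longrightarrow> (\<exists>f. is_coloring X k F f))"

text \<open>The infimum ranges over all hypergraphs with vertices in the type \<open>'a\<close>. It is attained
  whenever such a hypergraph exists, as \<^typ>\<open>enat\<close> is well-ordered, and is \<open>\<infinity>\<close> otherwise
  (which can happen if \<open>'a\<close> is a finite type). For infinite \<open>'a\<close> and \<open>k \<ge> 1\<close> it does not depend on
  \<open>'a\<close>: hypergraphs with infinitely many edges contribute \<open>\<infinity>\<close>, and for those with finitely many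
  (finite) edges the vertices outside the edges play no role.\<close>

definition m_tilde :: "'a itself \<Rightarrow> nat \<Rightarrow> nat \<Rightarrow> enat" where
  "m_tilde _ k r =
     Inf {num_edges H | (X :: 'a set) H.
            hypergraph_on X H \<and> uniform r H \<and> \<not> DP_colorable X k H}"

end

theory Submission
  imports Defs
begin

text \<open>
  Let \<open>H\<close> be \<open>r\<close>-uniform with at most \<open>2 ^ (r - 1)\<close> edges and let \<open>F\<close> be a 2-fold cover of \<open>H\<close>
  without a colouring. A 2-colouring of the finite set \<open>V = \<Union>H\<close> is encoded by the set \<open>A \<subseteq> V\<close> of
  vertices of colour 1. The colourings that extend a given \<open>\<phi> \<in> F\<close> then form a subcube of \<open>Pow V\<close>
  of size \<open>2 ^ (card V - r)\<close>. Two members of \<open>F\<close> with the same domain are complementary, so there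
  are at most two of them per edge and at most \<open>2 ^ r\<close> in total. As these subcubes cover all
  \<open>2 ^ card V\<close> colourings, the count leaves no slack: they partition \<open>Pow V\<close>.

  Parity rules such a partition out. Fix an edge \<open>e\<close> that is the domain of some member of \<open>F\<close> and
  sum the sign \<open>(-1) ^ card (A \<inter> e)\<close> over all \<open>A \<subseteq> V\<close>; this is the Fourier coefficient at \<open>e\<close> of the
  constant function 1, hence 0. On the other hand it is the total of the sums over the subcubes.
  A subcube whose fixed coordinates are an edge other than \<open>e\<close> leaves some vertex of \<open>e\<close> free, and
  flipping that vertex shows that its sum vanishes (\<open>sum_sign_subcube_eq_0\<close>). On a subcube with
  fixed coordinates \<open>e\<close> the sign is constant. Since \<open>r\<close> is even, a subset of \<open>e\<close> and its complement
  in \<open>e\<close> have sizes of the same parity, so the subcubes over \<open>e\<close> all have the same sign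
  (\<open>fold_cover_same_sign\<close>) and cannot cancel.
\<close>

section \<open>Subcubes of a power set\<close>

definition subcube :: "'a set \<Rightarrow> 'a set \<Rightarrow> 'a set \<Rightarrow> 'a set set" where
  "subcube V D Q = {A \<in> Pow V. A \<inter> D = Q}"

lemma subcube_empty: "subcube V {} {} = Pow V"
  by (auto simp: subcube_def)

lemma card_subcube:
  assumes "finite V" "D \<subseteq> V" "Q \<subseteq> D"
  shows "card (subcube V D Q) = 2 ^ (card V - card D)"
proof -
  have "bij_betw (\<lambda>A. A - D) (subcube V D Q) (Pow (V - D))"
    by (rule bij_betw_byWitness[where f' = "\<lambda>B. B \<union> Q"]) (use assms in \<open>auto simp: subcube_def\<close>)
  hence "card (subcube V D Q) = card (Pow (V - D))"
    by (rule bij_betw_same_card)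
  also have "\<dots> = 2 ^ (card V - card D)"
    using assms by (simp add: card_Pow card_Diff_subset finite_subset)
  finally show ?thesis .
qed

text \<open>Flipping a free coordinate in \<open>e\<close> is an involution of the subcube that reverses the sign.\<close>

lemma sum_sign_subcube_eq_0:
  assumes "finite e" "x \<in> e" "x \<in> V" "x \<notin> D"
  shows "(\<Sum>A\<in>subcube V D Q. (-1::int) ^ card (A \<inter> e)) = 0"
proof -
  define flip where "flip A = (if x \<in> A then A - {x} else insert x A)" for A
  have invol: "flip (flip A) = A" for A
    by (auto simp: flip_def)
  have mem: "flip A \<in> subcube V D Q" if "A \<in> subcube V D Q" for A
    using that assms by (auto simp: flip_def subcube_def)
  have sign: "(-1::int) ^ card (flip A \<inter> e) = - ((-1) ^ card (A \<inter> e))" for A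
  proof (cases "x \<in> A")
    case True
    hence "A \<inter> e = insert x (flip A \<inter> e)" "x \<notin> flip A \<inter> e"
      using assms by (auto simp: flip_def)
    hence "card (A \<inter> e) = Suc (card (flip A \<inter> e))"
      using assms by simp
    thus ?thesis by simp
  next
    case False
    hence "flip A \<inter> e = insert x (A \<inter> e)"
      using assms by (auto simp: flip_def)
    hence "card (flip A \<inter> e) = Suc (card (A \<inter> e))"
      using assms False by simp
    thus ?thesis by simp
  qed
  have "(\<Sum>A\<in>subcube V D Q. (-1::int) ^ card (A \<inter> e)) =
        (\<Sum>A\<in>subcube V D Q. - ((-1) ^ card (A \<inter> e)))"
    by (rule sum.reindex_bij_witness[where i = flip and j = flip]) (simp_all add: invol mem sign)
  thus ?thesis by (simp add: sum_negf)
qed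

section \<open>Two-fold covers\<close>

definition ones :: "('a \<rightharpoonup> nat) \<Rightarrow> 'a set" where
  "ones \<phi> = {x. \<phi> x = Some 1}"

lemma ones_subset_dom: "ones \<phi> \<subseteq> dom \<phi>"
  by (auto simp: ones_def)

lemma partial_maps_2_cases:
  assumes "\<phi> \<in> partial_maps X 2" "x \<in> dom \<phi>"
  shows "\<phi> x = Some 0 \<or> \<phi> x = Some 1"
proof -
  obtain c where c: "\<phi> x = Some c" using assms(2) by auto
  hence "c \<in> ran \<phi>" by (auto simp: ran_def)
  hence "c < 2" using assms(1) by (auto simp: partial_maps_def)
  thus ?thesis using c by auto
qed

lemma fold_cover_distinct_values:
  assumes "fold_cover X k H F" "\<phi> \<in> F" "\<psi> \<in> F" "\<phi> \<noteq> \<psi>" "dom \<phi> = dom \<psi>" "x \<in> dom \<phi>"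
  shows "\<phi> x \<noteq> \<psi> x"
proof
  assume eq: "\<phi> x = \<psi> x"
  obtain c where "\<phi> x = Some c" using assms(6) by auto
  hence "(x, c) \<in> Map.graph \<phi> \<inter> Map.graph \<psi>"
    using eq by (auto simp: Map.graph_def)
  thus False using assms unfolding fold_cover_def by blast
qed

text \<open>Members over the same edge are separated by their value at any vertex of that edge.\<close>

lemma fold_cover_card_over_edge:
  assumes "fold_cover X k H F" "e \<noteq> {}"
  shows "finite {\<phi>\<in>F. dom \<phi> = e}" "card {\<phi>\<in>F. dom \<phi> = e} \<le> k"
proof -
  obtain x where x: "x \<in> e" using assms(2) by blast
  have inj: "inj_on (\<lambda>\<phi>. the (\<phi> x)) {\<phi>\<in>F. dom \<phi> = e}"
  proof (rule inj_onI, rule ccontr)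
    fix \<phi> \<psi> assume *: "\<phi> \<in> {\<phi>\<in>F. dom \<phi> = e}" "\<psi> \<in> {\<phi>\<in>F. dom \<phi> = e}"
      "the (\<phi> x) = the (\<psi> x)" "\<phi> \<noteq> \<psi>"
    hence "x \<in> dom \<phi>" "x \<in> dom \<psi>" using x by auto
    hence "\<phi> x = \<psi> x" using *(3) by auto
    thus False using fold_cover_distinct_values[OF assms(1), of \<phi> \<psi> x] * x by auto
  qed
  have sub: "(\<lambda>\<phi>. the (\<phi> x)) ` {\<phi>\<in>F. dom \<phi> = e} \<subseteq> {..<k}"
  proof (rule image_subsetI)
    fix \<phi> assume *: "\<phi> \<in> {\<phi>\<in>F. dom \<phi> = e}"
    then obtain c where c: "\<phi> x = Some c" using x by auto
    hence "c \<in> ran \<phi>" by (auto simp: ran_def)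
    thus "the (\<phi> x) \<in> {..<k}"
      using * assms(1) c by (auto simp: fold_cover_def partial_maps_def)
  qed
  show "finite {\<phi>\<in>F. dom \<phi> = e}"
    using inj_on_finite[OF inj sub] by simp
  show "card {\<phi>\<in>F. dom \<phi> = e} \<le> k"
    using card_inj_on_le[OF inj sub] by simp
qed

lemma fold_cover_card_le:
  assumes "fold_cover X k H F" "finite H" "{} \<notin> H"
  shows "finite F" "card F \<le> k * card H"
proof -
  have F: "F = (\<Union>e\<in>H. {\<phi>\<in>F. dom \<phi> = e})"
    using assms(1) by (auto simp: fold_cover_def)
  have over: "finite {\<phi>\<in>F. dom \<phi> = e}" "card {\<phi>\<in>F. dom \<phi> = e} \<le> k" if "e \<in> H" for e
    using fold_cover_card_over_edge[OF assms(1), of e] that assms(3) by auto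
  show "finite F"
    by (subst F) (use over assms(2) in blast)
  have "card F \<le> (\<Sum>e\<in>H. card {\<phi>\<in>F. dom \<phi> = e})"
    by (subst F) (rule card_UN_le[OF assms(2)])
  also have "\<dots> \<le> (\<Sum>e\<in>H. k)"
    by (rule sum_mono) (rule over)
  finally show "card F \<le> k * card H" by (simp add: mult.commute)
qed

text \<open>Distinct members over one edge are complementary, and the edge has even size.\<close>

lemma fold_cover_same_sign:
  assumes cov: "fold_cover X 2 H F" and "\<phi> \<in> F" "\<psi> \<in> F" "dom \<phi> = e" "dom \<psi> = e"
    and "finite e" "even (card e)"
  shows "(-1::int) ^ card (ones \<psi>) = (-1) ^ card (ones \<phi>)"
proof (cases "\<phi> = \<psi>")
  case False
  have "F \<subseteq> partial_maps X 2"
    using cov by (simp add: fold_cover_def)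
  hence two: "\<chi> x = Some 0 \<or> \<chi> x = Some 1" if "\<chi> \<in> F" "x \<in> dom \<chi>" for \<chi> x
    by (rule partial_maps_2_cases[OF subsetD]) (fact that)+
  have sub: "ones \<phi> \<subseteq> e" "ones \<psi> \<subseteq> e"
    using ones_subset_dom[of \<phi>] ones_subset_dom[of \<psi>] assms(4,5) by simp_all
  have compl: "ones \<psi> = e - ones \<phi>"
  proof (rule set_eqI)
    fix x
    show "x \<in> ones \<psi> \<longleftrightarrow> x \<in> e - ones \<phi>"
    proof (cases "x \<in> e")
      case True
      hence "x \<in> dom \<phi>" "x \<in> dom \<psi>" using assms(4,5) by simp_all
      hence "\<phi> x = Some 0 \<or> \<phi> x = Some 1" "\<psi> x = Some 0 \<or> \<psi> x = Some 1" "\<phi> x \<noteq> \<psi> x"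
        using two fold_cover_distinct_values[OF cov assms(2,3) False] assms(2-5) by simp_all
      thus ?thesis using True by (auto simp: ones_def)
    qed (use sub in auto)
  qed
  have "card e = card (ones \<psi>) + card (ones \<phi>)"
    unfolding compl
    using \<open>finite e\<close> sub(1) card_Diff_subset[of "ones \<phi>" e] card_mono[of e "ones \<phi>"]
    by (simp add: finite_subset)
  hence "even (card (ones \<psi>)) \<longleftrightarrow> even (card (ones \<phi>))"
    using \<open>even (card e)\<close> by simp
  thus ?thesis by (simp add: minus_one_power_iff)
qed simp

section \<open>Colouring hypergraphs with few edges\<close>

text \<open>
  \<open>X\<close> may be infinite, while counting needs a finite \<open>V\<close>: vertices outside \<open>V\<close> receive colour 0.
\<close>

lemma uncolorable_subcubes_cover:
  assumes cov: "fold_cover X 2 H F" and nocol: "\<nexists>f. is_coloring X 2 F f" and "A \<subseteq> V"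
  shows "\<exists>\<phi>\<in>F. A \<in> subcube V (dom \<phi>) (ones \<phi>)"
proof -
  define f where "f = (\<lambda>x. if x \<in> X then Some (if x \<in> A then 1 else 0 :: nat) else None)"
  have "dom f = X" "ran f \<subseteq> {..<2}"
    by (auto simp: f_def ran_def split: if_splits)
  then obtain \<phi> where \<phi>: "\<phi> \<in> F" "\<phi> \<subseteq>\<^sub>m f"
    using nocol by (auto simp: is_coloring_def)
  have "dom \<phi> \<subseteq> X"
    using cov \<phi>(1) by (auto simp: fold_cover_def partial_maps_def)
  hence "\<phi> x = Some (if x \<in> A then 1 else 0)" if "x \<in> dom \<phi>" for x
    using \<phi>(2) that by (auto simp: map_le_def f_def)
  hence "A \<inter> dom \<phi> = ones \<phi>"
    using ones_subset_dom[of \<phi>] by (fastforce simp: ones_def split: if_splits)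
  thus ?thesis using \<phi>(1) \<open>A \<subseteq> V\<close> by (auto simp: subcube_def)
qed

text \<open>
  The non-strict bound on \<open>card H\<close> is what goes beyond the first-moment argument: equality forces
  every colouring to extend exactly one member of the cover, and the parity argument excludes that.
\<close>

lemma DP_colorable_2_if_few_edges:
  assumes unif: "uniform r H" and finH: "finite H" and cardH: "card H \<le> 2 ^ (r - 1)"
    and "r \<ge> 1" "even r"
  shows "DP_colorable X 2 H"
  unfolding DP_colorable_def
proof (intro allI impI, rule ccontr)
  fix F assume cov: "fold_cover X 2 H F" and nocol: "\<nexists>f. is_coloring X 2 F f"
  define V where "V = \<Union>H"
  define cube where "cube \<phi> = subcube V (dom \<phi>) (ones \<phi>)" for \<phi> :: "'a \<rightharpoonup> nat"
  define N where "N = (2::nat) ^ (card V - r)"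

  have edge: "finite e" "card e = r" if "e \<in> H" for e
    using unif that by (auto simp: uniform_def)
  have dom_edge: "dom \<phi> \<in> H" if "\<phi> \<in> F" for \<phi>
    using cov that by (auto simp: fold_cover_def)
  have finV: "finite V" using finH edge by (auto simp: V_def)
  have "{} \<notin> H" using edge \<open>r \<ge> 1\<close> by fastforce
  note F_le = fold_cover_card_le[OF cov finH this]
  have finF: "finite F" by (rule F_le)
  have "card F \<le> 2 * card H" by (rule F_le)
  also have "2 * card H \<le> 2 * 2 ^ (r - 1)" using cardH by simp
  also have "\<dots> = 2 ^ r" using \<open>r \<ge> 1\<close> by (cases r) auto
  finally have cardF: "card F \<le> 2 ^ r" .

  have card_cube: "card (cube \<phi>) = N" if "\<phi> \<in> F" for \<phi>
  proof -
    have "dom \<phi> \<subseteq> V" using dom_edge[OF that] by (auto simp: V_def)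
    thus ?thesis
      using card_subcube[OF finV _ ones_subset_dom] edge[OF dom_edge[OF that]]
      by (simp add: cube_def N_def)
  qed
  have cube_sub: "cube \<phi> \<subseteq> Pow V" for \<phi> by (auto simp: cube_def subcube_def)

  have covered: "\<exists>\<phi>\<in>F. A \<in> cube \<phi>" if "A \<in> Pow V" for A
    using uncolorable_subcubes_cover[OF cov nocol] that by (simp add: cube_def)
  then obtain \<phi>\<^sub>0 where \<phi>\<^sub>0: "\<phi>\<^sub>0 \<in> F" by blast
  define e where "e = dom \<phi>\<^sub>0"
  have e: "e \<in> H" "finite e" "card e = r" "e \<subseteq> V"
    using dom_edge[OF \<phi>\<^sub>0] edge by (auto simp: e_def V_def)
  have "r \<le> card V" using card_mono[OF finV e(4)] e(3) by simp

  define mult where "mult A = card {\<phi>\<in>F. A \<in> cube \<phi>}" for A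
  have double_count: "(\<Sum>A\<in>Pow V. of_nat (mult A) * g A) = (\<Sum>\<phi>\<in>F. \<Sum>A\<in>cube \<phi>. g A)"
    for g :: "'a set \<Rightarrow> int"
  proof -
    have "(\<Sum>A\<in>Pow V. of_nat (mult A) * g A) = (\<Sum>A\<in>Pow V. \<Sum>\<phi> | \<phi> \<in> F \<and> A \<in> cube \<phi>. g A)"
      by (simp add: mult_def)
    also have "\<dots> = (\<Sum>\<phi>\<in>F. \<Sum>A | A \<in> Pow V \<and> A \<in> cube \<phi>. g A)"
      by (rule sum.swap_restrict) (use finV finF in auto)
    also have "\<dots> = (\<Sum>\<phi>\<in>F. \<Sum>A\<in>cube \<phi>. g A)"
      by (intro sum.cong refl) (use cube_sub in auto)
    finally show ?thesis .
  qed

  have mult_ge: "mult A \<ge> 1" if "A \<in> Pow V" for A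
  proof -
    have "{\<phi>\<in>F. A \<in> cube \<phi>} \<noteq> {}" using covered[OF that] by blast
    thus ?thesis using finF by (simp add: mult_def Suc_le_eq card_gt_0_iff)
  qed
  have "(\<Sum>A\<in>Pow V. int (mult A)) = int (card F * N)"
    using double_count[of "\<lambda>_. 1"] card_cube by simp
  also have "\<dots> \<le> int (2 ^ r * N)"
    using cardF by (intro of_nat_mono mult_right_mono) auto
  also have "2 ^ r * N = card (Pow V)"
    using \<open>r \<le> card V\<close> finV by (simp add: N_def card_Pow flip: power_add)
  \<comment> \<open>Each summand is nonnegative, so the average bound 1 on \<open>mult\<close> holds with equality pointwise.\<close>
  finally have "(\<Sum>A\<in>Pow V. int (mult A) - 1) \<le> 0"
    by (simp add: sum_subtractf)
  moreover have nonneg: "int (mult A) - 1 \<ge> 0" if "A \<in> Pow V" for A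
    using mult_ge[OF that] by simp
  ultimately have "(\<Sum>A\<in>Pow V. int (mult A) - 1) = 0"
    using sum_nonneg[of "Pow V" "\<lambda>A. int (mult A) - 1"] by fastforce
  hence mult_1: "mult A = 1" if "A \<in> Pow V" for A
    using sum_nonneg_eq_0_iff[of "Pow V" "\<lambda>A. int (mult A) - 1"] nonneg finV that by simp

  define sign where "sign A = (-1::int) ^ card (A \<inter> e)" for A
  have "e \<noteq> {}" using e(3) \<open>r \<ge> 1\<close> by auto
  then obtain x where "x \<in> e" by blast
  hence "(\<Sum>A\<in>Pow V. sign A) = 0"
    using sum_sign_subcube_eq_0[OF e(2), of x V "{}" "{}"] e(4)
    by (auto simp: subcube_empty sign_def)
  moreover have "(\<Sum>A\<in>Pow V. sign A) = (\<Sum>A\<in>Pow V. of_nat (mult A) * sign A)"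
    by (rule sum.cong) (simp_all add: mult_1)
  ultimately have total: "(\<Sum>\<phi>\<in>F. \<Sum>A\<in>cube \<phi>. sign A) = 0"
    by (simp add: double_count)

  define s where "s = (-1::int) ^ card (ones \<phi>\<^sub>0)"
  have "(\<Sum>A\<in>cube \<phi>. sign A) = (if dom \<phi> = e then s * int N else 0)" if "\<phi> \<in> F" for \<phi>
  proof (cases "dom \<phi> = e")
    case True
    have "(\<Sum>A\<in>cube \<phi>. sign A) = (\<Sum>A\<in>cube \<phi>. s)"
    proof (rule sum.cong)
      fix A assume "A \<in> cube \<phi>"
      hence "A \<inter> e = ones \<phi>" using True by (auto simp: cube_def subcube_def)
      thus "sign A = s"
        using fold_cover_same_sign[OF cov \<phi>\<^sub>0 that e_def[symmetric] True e(2)] e(3) \<open>even r\<close>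
        by (simp add: sign_def s_def)
    qed simp
    thus ?thesis using True card_cube[OF that] by simp
  next
    case False
    \<comment> \<open>Both sets have size \<open>r\<close>.\<close>
    have "\<not> e \<subseteq> dom \<phi>"
      using False card_subset_eq[of "dom \<phi>" e] edge[OF dom_edge[OF that]] e(3) by auto
    then obtain y where "y \<in> e" "y \<notin> dom \<phi>" by blast
    thus ?thesis
      using sum_sign_subcube_eq_0[OF e(2), of y V "dom \<phi>" "ones \<phi>"] e(4) False
      by (auto simp: cube_def sign_def)
  qed
  hence "(\<Sum>\<phi>\<in>F. \<Sum>A\<in>cube \<phi>. sign A) = (\<Sum>\<phi>\<in>F. if dom \<phi> = e then s * int N else 0)"
    by (rule sum.cong[OF refl])
  also have "\<dots> = int (card {\<phi>\<in>F. dom \<phi> = e}) * (s * int N)"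
    using finF by (simp flip: sum.inter_filter)
  finally have "card {\<phi>\<in>F. dom \<phi> = e} = 0"
    using total by (simp add: s_def N_def)
  thus False using \<phi>\<^sub>0 finF by (auto simp: e_def)
qed

theorem theorem1p18:
  fixes r :: nat
  assumes "r \<ge> 1" and "even r"
  shows "m_tilde TYPE('a) 2 r \<ge> enat (2 ^ (r - 1) + 1)"
  unfolding m_tilde_def
proof (rule Inf_greatest)
  fix n assume "n \<in> {num_edges H | (X :: 'a set) H.
            hypergraph_on X H \<and> uniform r H \<and> \<not> DP_colorable X 2 H}"
  then obtain X :: "'a set" and H where H: "n = num_edges H" "uniform r H"
      "\<not> DP_colorable X 2 H"
    by blast
  show "enat (2 ^ (r - 1) + 1) \<le> n"
  proof (cases "finite H")
    case True
    hence "\<not> card H \<le> 2 ^ (r - 1)"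
      using DP_colorable_2_if_few_edges[OF H(2) True _ assms] H(3) by blast
    thus ?thesis using True H(1) by (simp add: num_edges_def)
  qed (simp add: H(1) num_edges_def)
qed

end
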